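(* Let $\hat B_1,\dots,\hat B_n$, $\hat B_i(x)=\sum_{j=1}^n S_{ij}B_j(x)$ with $\boldsymbol S\in\mathbb{SPD}^n$, be an approximate dual basis to the B-splines $B_1,\dots,B_n$ of the spline space $\mathbb{S}^p_r$ on $[a,b]$. Let $f\in L^2([a,b])$ and $\hat{\boldsymbol G}=\boldsymbol S^{-1}$. Then the spline function $$u(x)=\sum_{i=1}^n\langle f,\hat B_i\rangle\,B_i(x)$$ is the unique solution to the convex minimization problem $$\underset{u\in\mathbb{S}^p_r}{\operatorname{argmin}}\ \tfrac12\langle u,u\rangle_{\hat G}-\langle u,f\rangle .$$ Furthermore, $u=f$ whenever $f\in\mathbb{P}^p$.
   Context: Spline space. Let $a=x_0<x_1<\dots<x_\delta=b$ be a partition of $[a,b]$ into $\delta$ elements, let $p$ be the polynomial degree, and let $r=(r_1,\dots,r_{\delta-1})$ be integers with $0\le r_k\le p-1$. The knot vector $(t_i)_{i=1}^{n+p+1}$ is the nondecreasing sequence in which $x_0$ and $x_\delta$ are each repeated $p+1$ times and each interior breakpoint $x_k$ ($1\le k\le\delta-1$) is repeated $p-r_k$ times. The B-splines $B_i=B_{i,p}$, $i=1,\dots,n$, are defined by the Cox–de Boor recursion: $B_{i,0}(x)=1$ if $x\in[t_i,t_{i+1})$ and $0$ otherwise, and $$B_{i,p}(x)=\frac{x-t_i}{t_{i+p}-t_i}B_{i,p-1}(x)+\frac{t_{i+p+1}-x}{t_{i+p+1}-t_{i+1}}B_{i+1,p-1}(x),$$ with the convention $0/0=0$, and with the usual convention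 that the last nonempty knot interval is closed at $b$. The spline space is $\mathbb{S}^p_r=\operatorname{span}(B_1,\dots,B_n)$; it is the space of piecewise polynomials of degree $p$ having $r_k$ continuous derivatives at $x_k$, has dimension $n$, and contains the space $\mathbb{P}^p$ of polynomials of degree $<p+1$ on $[a,b]$. Inner product and dual basis. $\langle\cdot,\cdot\rangle$ is the standard $L^2([a,b])$ inner product. The Grammian matrix is $\boldsymbol G=[G_{ij}]$, $G_{ij}=\langle B_i,B_j\rangle$. The $L^2$ dual basis functions in $\mathbb{S}^p_r$ are $\tilde B_i=\sum_{j=1}^n(\boldsymbol G^{-1})_{ij}B_j$, so that $\langle\tilde B_i,B_j\rangle=\delta_{ij}$. Approximate dual basis. $\mathbb{SPD}^n$ is the set of symmetric positive definite real $n\times n$ matrices. For $\boldsymbol S\in\mathbb{SPD}^n$, the functions $\hat B_i=\sum_{j=1}^nS_{ij}B_j$, $i=1,\dots,n$, are called an approximate dual basis to the set of B-splines if $\langle f,\hat B_i\rangle=\langle f,\tilde B_i\rangle$ for all $f\in\mathbb{P}^p$ and all $i=1,\dots,n$. Discrete inner product. For $\hat{\boldsymbol G}\in\mathbb{SPD}^n$ and $u=\sum_iu_iB_i$, $v=\sum_iv_iB_i$ in $\mathbb{S}^p_r$, set $\langle u,v\rangle_{\hat G}:=\sum_{i=1}^n\sum_{j=1}^nu_i\hat G_{ij}v_j$. *)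

theory Defs
  imports
    "HOL-Analysis.Analysis"
    "HOL-Computational_Algebra.Polynomial"
    "Jordan_Normal_Form.Gauss_Jordan_Elimination"
begin

text \<open>All indices start at 0: the knots are \<open>t ! 0, \<dots>, t ! (n + p)\<close>, the B-splines are
  \<open>B 0, \<dots>, B (n - 1)\<close>, and the matrix entries are indexed by \<open>{0..<n}\<close>.
  The breakpoints keep their indices \<open>0, \<dots>, \<delta>\<close>.\<close>

definition knot_vector :: "nat \<Rightarrow> nat \<Rightarrow> (nat \<Rightarrow> nat) \<Rightarrow> (nat \<Rightarrow> real) \<Rightarrow> real list" where
  "knot_vector p \<delta> r x =
     replicate (p + 1) (x 0)
     @ concat (map (\<lambda>k. replicate (p - r k) (x k)) [1..<\<delta>])
     @ replicate (p + 1) (x \<delta>)"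

text \<open>The knot vector has length \<open>n + p + 1\<close>.\<close>

definition num_bsplines :: "nat \<Rightarrow> real list \<Rightarrow> nat" where
  "num_bsplines p t = length t - (p + 1)"

text \<open>Cox--de Boor recursion.  The convention \<open>0/0 = 0\<close> is provided by the division of HOL.
  The second disjunct in degree 0 closes the last nonempty knot interval at the right end point.
  With it all B-splines vanish outside the interval spanned by the knots, so that two splines
  are equal as functions on the real line iff they are equal on that interval.\<close>

fun bspline :: "real list \<Rightarrow> nat \<Rightarrow> nat \<Rightarrow> real \<Rightarrow> real" where
  "bspline t 0 i x =
     (if t ! i \<le> x \<and> x < t ! (i + 1)
         \<or> t ! i < t ! (i + 1) \<and> t ! (i + 1) = last t \<and> x = last t
      then 1 else 0)"
| "bspline t (Suc p) i x =
     (x - t ! i) / (t ! (i + Suc p) - t ! i) * bspline t p i x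
     + (t ! (i + Suc p + 1) - x) / (t ! (i + Suc p + 1) - t ! (i + 1)) * bspline t p (i + 1) x"

definition bspline_comb :: "nat \<Rightarrow> real list \<Rightarrow> (nat \<Rightarrow> real) \<Rightarrow> real \<Rightarrow> real" where
  "bspline_comb p t c = (\<lambda>x. \<Sum>i<num_bsplines p t. c i * bspline t p i x)"

definition spline_space :: "nat \<Rightarrow> real list \<Rightarrow> (real \<Rightarrow> real) set" where
  "spline_space p t = {bspline_comb p t c |c. True}"

definition poly_space :: "real \<Rightarrow> real \<Rightarrow> nat \<Rightarrow> (real \<Rightarrow> real) set" where
  "poly_space a b p = {f. \<exists>q. degree q \<le> p \<and> (\<forall>x\<in>{a..b}. f x = poly q x)}"

definition L2_space :: "real \<Rightarrow> real \<Rightarrow> (real \<Rightarrow> real) set" where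
  "L2_space a b = {f \<in> borel_measurable (lebesgue_on {a..b}).
                     integrable (lebesgue_on {a..b}) (\<lambda>x. (f x)\<^sup>2)}"

definition L2_inner :: "real \<Rightarrow> real \<Rightarrow> (real \<Rightarrow> real) \<Rightarrow> (real \<Rightarrow> real) \<Rightarrow> real" where
  "L2_inner a b f g = integral\<^sup>L (lebesgue_on {a..b}) (\<lambda>x. f x * g x)"

definition SPD :: "nat \<Rightarrow> real mat set" where
  "SPD n = {A \<in> carrier_mat n n. transpose_mat A = A \<and>
              (\<forall>v \<in> carrier_vec n. v \<noteq> 0\<^sub>v n \<longrightarrow> scalar_prod v (A *\<^sub>v v) > 0)}"

definition matrix_inverse :: "real mat \<Rightarrow> real mat" where
  "matrix_inverse A = the (mat_inverse A)"

definition gram_matrix :: "real \<Rightarrow> real \<Rightarrow> nat \<Rightarrow> real list \<Rightarrow> real mat" where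
  "gram_matrix a b p t = mat (num_bsplines p t) (num_bsplines p t)
     (\<lambda>(i, j). L2_inner a b (bspline t p i) (bspline t p j))"

definition dual_bspline :: "real \<Rightarrow> real \<Rightarrow> nat \<Rightarrow> real list \<Rightarrow> nat \<Rightarrow> real \<Rightarrow> real" where
  "dual_bspline a b p t i =
     bspline_comb p t (\<lambda>j. matrix_inverse (gram_matrix a b p t) $$ (i, j))"

definition approx_dual_bspline :: "nat \<Rightarrow> real list \<Rightarrow> real mat \<Rightarrow> nat \<Rightarrow> real \<Rightarrow> real" where
  "approx_dual_bspline p t S i = bspline_comb p t (\<lambda>j. S $$ (i, j))"

definition is_approx_dual_basis :: "real \<Rightarrow> real \<Rightarrow> nat \<Rightarrow> real list \<Rightarrow> real mat \<Rightarrow> bool" where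
  "is_approx_dual_basis a b p t S \<longleftrightarrow>
     S \<in> SPD (num_bsplines p t) \<and>
     (\<forall>f \<in> poly_space a b p. \<forall>i < num_bsplines p t.
        L2_inner a b f (approx_dual_bspline p t S i) = L2_inner a b f (dual_bspline a b p t i))"

text \<open>The coefficients of a spline; extending them by 0 beyond the index range makes them
  unique, as the B-splines are linearly independent.\<close>

definition bspline_coeffs :: "nat \<Rightarrow> real list \<Rightarrow> (real \<Rightarrow> real) \<Rightarrow> nat \<Rightarrow> real" where
  "bspline_coeffs p t u =
     (THE c. (\<forall>i \<ge> num_bsplines p t. c i = 0) \<and> u = bspline_comb p t c)"

definition discrete_inner ::
    "nat \<Rightarrow> real list \<Rightarrow> real mat \<Rightarrow> (real \<Rightarrow> real) \<Rightarrow> (real \<Rightarrow> real) \<Rightarrow> real" where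
  "discrete_inner p t Gh u v =
     (\<Sum>i<num_bsplines p t. \<Sum>j<num_bsplines p t.
        bspline_coeffs p t u i * Gh $$ (i, j) * bspline_coeffs p t v j)"

text \<open>Convexity of a functional on a convex set of functions, spelled out because the type of
  functions is not an instance of \<^class>\<open>real_vector\<close>.\<close>

definition convex_problem :: "(real \<Rightarrow> real) set \<Rightarrow> ((real \<Rightarrow> real) \<Rightarrow> real) \<Rightarrow> bool" where
  "convex_problem V J \<longleftrightarrow>
     (\<forall>v\<in>V. \<forall>w\<in>V. \<forall>s\<in>{0..1}.
        (\<lambda>x. (1 - s) * v x + s * w x) \<in> V \<and>
        J (\<lambda>x. (1 - s) * v x + s * w x) \<le> (1 - s) * J v + s * J w)"

end

theory Submission
  imports Defs "Jordan_Normal_Form.Determinant"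
begin

text \<open>On a nonempty knot interval the B-splines are polynomials.  Marsden's identity writes the
  monomials of degree at most \<open>p\<close> as combinations of the B-splines, with coefficients that do not
  depend on the interval.  So polynomials are splines, and by a dimension count the \<open>p + 1\<close>
  B-splines that are nonzero on the interval are linearly independent there.  Hence the Gram matrix
  is positive definite.  In terms of coefficients, with \<open>\<phi>\<^sub>i = \<langle>f, B\<^sub>i\<rangle>\<close>, the functional is the
  quadratic function \<open>c\<^sup>T S\<inverse> c / 2 - c\<^sup>T \<phi>\<close>, which exceeds its value at \<open>S \<phi>\<close>, the coefficients of
  \<open>u\<close>, by the positive definite form \<open>S\<inverse> / 2\<close> of the difference.  If \<open>f\<close> is a polynomial,
  \<open>S \<phi>\<close> agrees with the pairings of \<open>f\<close> with the dual basis, which are the coefficients of \<open>f\<close>.\<close>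

section \<open>Polynomial pieces, Marsden's identity and local linear independence\<close>

text \<open>\<open>bspline_piece t m q i\<close> is the polynomial that agrees with \<open>B\<^sub>i\<close> of degree \<open>q\<close> on the interval
  from \<open>t ! m\<close> to \<open>t ! (m + 1)\<close>.\<close>

fun bspline_piece :: "real list \<Rightarrow> nat \<Rightarrow> nat \<Rightarrow> nat \<Rightarrow> real poly" where
  "bspline_piece t m 0 i = (if i = m then 1 else 0)"
| "bspline_piece t m (Suc q) i =
     (let d = t ! (i + Suc q) - t ! i; e = t ! (i + Suc q + 1) - t ! (i + 1)
      in [:- (t ! i / d), 1 / d:] * bspline_piece t m q i
         + [:t ! (i + Suc q + 1) / e, - (1 / e):] * bspline_piece t m q (i + 1))"

text \<open>The point \<open>x\<close> enters only through the degree 0 values, so half-open knot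
  intervals and the closed last one are treated alike.\<close>

lemma bspline_eq_piece:
  assumes "\<And>i. i + 1 < length t \<Longrightarrow> bspline t 0 i x = (if i = m then 1 else 0)"
  shows "i + q + 1 < length t \<Longrightarrow> bspline t q i x = poly (bspline_piece t m q i) x"
proof (induction q arbitrary: i)
  case 0
  then show ?case using assms[of i] by simp
next
  case (Suc q)
  then show ?case using Suc.IH[of i] Suc.IH[of "i + 1"]
    by (simp add: Let_def diff_divide_distrib algebra_simps)
qed

lemma bspline_piece_eq_0:
  "\<not> (i \<le> m \<and> m \<le> i + q) \<Longrightarrow> bspline_piece t m q i = 0"
  by (induction q arbitrary: i) auto

text \<open>Induction on the degree: both terms of the recursion are collected at the same piece
  \<open>i\<close>, where linear interpolation turns them into the factor
  \<open>y - x\<close>.\<close>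

lemma marsden_identity:
  assumes "sorted t" "t ! m < t ! (m + 1)"
  shows "q \<le> m \<Longrightarrow> m + q + 1 < length t \<Longrightarrow>
    (\<Sum>i\<le>m. (\<Prod>l<q. y - t ! (i + Suc l)) * poly (bspline_piece t m q i) x) = (y - x) ^ q"
proof (induction q)
  case 0
  have "(\<Sum>i\<le>m. poly (bspline_piece t m 0 i) x) = (\<Sum>i\<le>m. if i = m then 1 else 0)"
    by (rule sum.cong) auto
  then show ?case by simp
next
  case (Suc q)
  define A where "A i = poly (bspline_piece t m q i) x" for i
  define P where "P i = (\<Prod>l<q. y - t ! (i + Suc l))" for i
  \<comment> \<open>\<open>g (Suc i)\<close> is what the second recursion term contributes at
    \<open>i\<close>; after an index shift it carries the same \<open>A i\<close> as the first
    term.\<close>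
  define g where "g i = (y - t ! i) * P i * ((t ! (i + q + 1) - x) / (t ! (i + q + 1) - t ! i)) * A i" for i
  have A0: "A i = 0" if "\<not> (i \<le> m \<and> m \<le> i + q)" for i
    using that unfolding A_def by (simp add: bspline_piece_eq_0)
  have P1: "(\<Prod>l<Suc q. y - t ! (i + Suc l)) = P i * (y - t ! (i + q + 1))" for i
    unfolding P_def by simp
  have P2: "(\<Prod>l<Suc q. y - t ! (i + Suc l)) = (y - t ! (i + 1)) * P (i + 1)" for i
    unfolding P_def by (subst prod.lessThan_Suc_shift) simp
  have "(\<Sum>i\<le>m. (\<Prod>l<Suc q. y - t ! (i + Suc l)) * poly (bspline_piece t m (Suc q) i) x)
    = (\<Sum>i\<le>m. P i * (y - t ! (i + q + 1)) * ((x - t ! i) / (t ! (i + q + 1) - t ! i)) * A i + g (Suc i))"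
  proof (rule sum.cong)
    fix i
    let ?\<psi> = "\<Prod>l<Suc q. y - t ! (i + Suc l)"
    have "poly (bspline_piece t m (Suc q) i) x = (x - t ! i) / (t ! (i + q + 1) - t ! i) * A i
       + (t ! (i + 1 + q + 1) - x) / (t ! (i + 1 + q + 1) - t ! (i + 1)) * A (i + 1)"
      unfolding bspline_piece.simps Let_def A_def by (simp add: diff_divide_distrib algebra_simps)
    then have "?\<psi> * poly (bspline_piece t m (Suc q) i) x
      = ?\<psi> * ((x - t ! i) / (t ! (i + q + 1) - t ! i)) * A i
       + ?\<psi> * ((t ! (i + 1 + q + 1) - x) / (t ! (i + 1 + q + 1) - t ! (i + 1))) * A (i + 1)"
      by (simp only: distrib_left mult.assoc)
    also have "\<dots> = P i * (y - t ! (i + q + 1)) * ((x - t ! i) / (t ! (i + q + 1) - t ! i)) * A i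
       + (y - t ! (i + 1)) * P (i + 1)
         * ((t ! (i + 1 + q + 1) - x) / (t ! (i + 1 + q + 1) - t ! (i + 1))) * A (i + 1)"
      using P1[of i] P2[of i] by (simp only:)
    finally show "?\<psi> * poly (bspline_piece t m (Suc q) i) x
      = P i * (y - t ! (i + q + 1)) * ((x - t ! i) / (t ! (i + q + 1) - t ! i)) * A i + g (Suc i)"
      unfolding g_def by simp
  qed simp
  also have "\<dots> = (\<Sum>i\<le>m. P i * (y - t ! (i + q + 1)) * ((x - t ! i) / (t ! (i + q + 1) - t ! i)) * A i)
      + (\<Sum>i\<le>m. g (Suc i))"
    by (rule sum.distrib)
  also have "(\<Sum>i\<le>m. g (Suc i)) = (\<Sum>i\<le>m. g i)"
  proof -
    \<comment> \<open>The shift loses nothing: the support of piece 0 of degree \<open>q\<close>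
      ends before interval \<open>m\<close>, as \<open>q < m\<close>, and that of piece
      \<open>Suc m\<close> starts after it.\<close>
    have "g 0 = 0" "g (Suc m) = 0"
      using Suc.prems by (simp_all add: g_def A0)
    then show ?thesis
      using sum.atMost_Suc_shift[of g m] by simp
  qed
  also have "(\<Sum>i\<le>m. P i * (y - t ! (i + q + 1)) * ((x - t ! i) / (t ! (i + q + 1) - t ! i)) * A i)
      + (\<Sum>i\<le>m. g i) = (\<Sum>i\<le>m. (y - x) * (P i * A i))"
    unfolding sum.distrib[symmetric]
  proof (rule sum.cong)
    fix i
    show "P i * (y - t ! (i + q + 1)) * ((x - t ! i) / (t ! (i + q + 1) - t ! i)) * A i + g i
      = (y - x) * (P i * A i)"
    proof (cases "i \<le> m \<and> m \<le> i + q")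
      case True
      have "t ! i \<le> t ! m" "t ! (m + 1) \<le> t ! (i + q + 1)"
        using True Suc.prems by (auto intro!: sorted_nth_mono[OF assms(1)])
      then have d: "t ! (i + q + 1) - t ! i \<noteq> 0" using assms(2) by simp
      \<comment> \<open>\<open>E\<close> and \<open>F\<close> write \<open>x\<close> as an affine
        combination of \<open>t ! (i + q + 1)\<close> and \<open>t ! i\<close>, so they interpolate
        the affine function \<open>y - z\<close> of \<open>z\<close> exactly.\<close>
      define E where "E = (x - t ! i) / (t ! (i + q + 1) - t ! i)"
      define F where "F = (t ! (i + q + 1) - x) / (t ! (i + q + 1) - t ! i)"
      have "(y - t ! (i + q + 1)) * E + (y - t ! i) * F
        = ((y - t ! (i + q + 1)) * (x - t ! i) + (y - t ! i) * (t ! (i + q + 1) - x))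
          / (t ! (i + q + 1) - t ! i)"
        by (simp add: E_def F_def add_divide_distrib)
      also have "\<dots> = (y - x) * (t ! (i + q + 1) - t ! i) / (t ! (i + q + 1) - t ! i)"
        by (rule arg_cong[where f = "\<lambda>z. z / _"]) (simp add: algebra_simps)
      finally have "(y - t ! (i + q + 1)) * E + (y - t ! i) * F = y - x"
        using d by simp
      then have "((y - t ! (i + q + 1)) * E + (y - t ! i) * F) * (P i * A i) = (y - x) * (P i * A i)"
        by simp
      then show ?thesis
        unfolding g_def E_def[symmetric] F_def[symmetric] by (simp only: distrib_left distrib_right mult_ac)
    qed (auto simp: g_def A0)
  qed simp
  also have "\<dots> = (y - x) * (y - x) ^ q"
    using Suc by (simp add: sum_distrib_left[symmetric] A_def P_def)
  finally show ?case by simp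
qed

text \<open>Comparing the coefficients of \<open>y ^ (q - j)\<close> in Marsden's identity.\<close>

definition monom_coeff :: "real list \<Rightarrow> nat \<Rightarrow> nat \<Rightarrow> nat \<Rightarrow> real" where
  "monom_coeff t q j i =
     (-1) ^ j / real (q choose j) * coeff (\<Prod>l<q. [:- t ! (i + Suc l), 1:]) (q - j)"

lemma power_eq_sum_pieces:
  assumes "sorted t" "t ! m < t ! (m + 1)" "q \<le> m" "m + q + 1 < length t" "j \<le> q"
  shows "x ^ j = (\<Sum>i\<le>m. monom_coeff t q j i * poly (bspline_piece t m q i) x)"
proof -
  let ?A = "\<lambda>i. poly (bspline_piece t m q i) x" and ?P = "\<lambda>i. \<Prod>l<q. [:- t ! (i + Suc l), 1:]"
  \<comment> \<open>Marsden's identity at a fixed \<open>x\<close>, read as an identity of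
    polynomials in \<open>y\<close>.\<close>
  have "(\<Sum>i\<le>m. [:?A i:] * ?P i) = [:-x, 1:] ^ q"
    unfolding poly_eq_poly_eq_iff[symmetric]
    using marsden_identity[OF assms(1-4)]
    by (auto simp: poly_sum poly_prod fun_eq_iff mult.commute add.commute)
  then have "coeff (\<Sum>i\<le>m. [:?A i:] * ?P i) (q - j) = real (q choose j) * (-x) ^ j"
    using assms(5) by (simp add: coeff_linear_poly_power binomial_symmetric[symmetric])
  then have "(\<Sum>i\<le>m. ?A i * coeff (?P i) (q - j)) = real (q choose j) * (-x) ^ j"
    by (simp add: coeff_sum)
  then have "(-1) ^ j / real (q choose j) * (\<Sum>i\<le>m. ?A i * coeff (?P i) (q - j)) = x ^ j"
    using assms(5) by (simp add: power_mult_distrib[symmetric])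
  then show ?thesis
    by (simp add: monom_coeff_def sum_distrib_left mult_ac)
qed

text \<open>The monomials up to degree \<open>q\<close> are combinations of the \<open>q + 1\<close> nonzero pieces, so the square
  matrix of the coefficients of the pieces has a left inverse, hence also a right inverse.\<close>

lemma bspline_pieces_independent:
  assumes "sorted t" "t ! m < t ! (m + 1)" "q \<le> m" "m + q + 1 < length t"
    and zero: "(\<Sum>i\<le>m. [:c i:] * bspline_piece t m q i) = 0"
    and i: "i \<le> m" "m \<le> i + q"
  shows "c i = 0"
proof -
  \<comment> \<open>For \<open>l \<le> q\<close>, \<open>k l\<close> runs through
    \<open>m - q, ..., m\<close>, outside of which all pieces are 0.\<close>
  define k where "k l = m - q + l" for l
  define b where "b l = bspline_piece t m q (k l)" for l
  have sum_k: "(\<Sum>i\<le>m. g i) = (\<Sum>l<q+1. g (k l))"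
    if "\<And>i. i < m - q \<Longrightarrow> g i = 0" for g :: "nat \<Rightarrow> 'b::comm_monoid_add"
  proof -
    have "(\<Sum>l<q+1. g (k l)) = (\<Sum>i\<in>{m-q..m}. g i)"
      by (rule sum.reindex_bij_witness[where i = "\<lambda>i. i - (m - q)" and j = k])
        (use assms(3) in \<open>auto simp: k_def\<close>)
    also have "\<dots> = (\<Sum>i\<le>m. g i)"
      by (rule sum.mono_neutral_left) (use that in auto)
    finally show ?thesis by simp
  qed
  have piece0: "bspline_piece t m q i = 0" if "i < m - q" for i
    using that by (intro bspline_piece_eq_0) auto
  \<comment> \<open>\<open>M\<close> expands monomials in the pieces, \<open>N\<close> expands
    pieces in the monomials.\<close>
  define M where "M = mat (q+1) (q+1) (\<lambda>(j, l). monom_coeff t q j (k l))"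
  define N where "N = mat (q+1) (q+1) (\<lambda>(l, j). coeff (b l) j)"
  have "M * N = 1\<^sub>m (q+1)"
  proof (rule eq_matI)
    fix j j' assume "j < dim_row (1\<^sub>m (q+1) :: real mat)" "j' < dim_col (1\<^sub>m (q+1) :: real mat)"
    then have j: "j < q+1" "j' < q+1" by auto
    have "(monom 1 j :: real poly) = (\<Sum>i\<le>m. [:monom_coeff t q j i:] * bspline_piece t m q i)"
      unfolding poly_eq_poly_eq_iff[symmetric]
      using power_eq_sum_pieces[OF assms(1-4), of j] j
      by (auto simp: poly_sum poly_monom fun_eq_iff)
    also have "\<dots> = (\<Sum>l<q+1. [:monom_coeff t q j (k l):] * b l)"
      unfolding b_def by (rule sum_k) (simp add: piece0)
    finally have "coeff (monom 1 j :: real poly) j' = coeff (\<Sum>l<q+1. [:monom_coeff t q j (k l):] * b l) j'"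
      by simp
    then show "(M * N) $$ (j, j') = 1\<^sub>m (q+1) $$ (j, j')"
      using j by (simp add: M_def N_def scalar_prod_def coeff_sum atLeast0LessThan del: sum.lessThan_Suc)
  qed (auto simp: M_def N_def)
  then have NM: "N * M = 1\<^sub>m (q+1)"
    by (rule mat_mult_left_right_inverse[rotated 2]) (auto simp: M_def N_def)
  \<comment> \<open>The vanishing combination says that \<open>N\<close> kills the row vector of the
    \<open>c (k l)\<close>; multiplying by \<open>M\<close> on the right recovers that
    vector.\<close>
  have cN: "(\<Sum>l<q+1. c (k l) * N $$ (l, j)) = 0" if "j < q + 1" for j
  proof -
    have "(\<Sum>i\<le>m. [:c i:] * bspline_piece t m q i) = (\<Sum>l<q+1. [:c (k l):] * b l)"
      unfolding b_def by (rule sum_k) (simp add: piece0)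
    then have "coeff (\<Sum>l<q+1. [:c (k l):] * b l) j = 0" using zero by simp
    then show ?thesis using that by (simp add: N_def coeff_sum del: sum.lessThan_Suc)
  qed
  define s where "s = i - (m - q)"
  have s: "s < q + 1" "k s = i" using i assms(3) by (auto simp: s_def k_def)
  have "c i = (\<Sum>l<q+1. c (k l) * 1\<^sub>m (q+1) $$ (l, s))"
    using s by (simp add: if_distrib cong: if_cong del: sum.lessThan_Suc)
  also have "\<dots> = (\<Sum>l<q+1. c (k l) * (\<Sum>j<q+1. N $$ (l, j) * M $$ (j, s)))"
    unfolding NM[symmetric]
    by (rule sum.cong)
      (use s in \<open>auto simp: scalar_prod_def M_def N_def atLeast0LessThan simp del: sum.lessThan_Suc\<close>)
  also have "\<dots> = (\<Sum>j<q+1. (\<Sum>l<q+1. c (k l) * N $$ (l, j)) * M $$ (j, s))"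
    unfolding sum_distrib_left sum_distrib_right
    by (subst sum.swap) (simp add: mult_ac)
  also have "\<dots> = 0" using cN by simp
  finally show ?thesis .
qed

section \<open>Open knot vectors\<close>

text \<open>Isolates what the spline arguments use of the knots. \<open>knots_gap\<close> bounds
  every multiplicity by \<open>p + 1\<close>, so that no B-spline has an empty support.\<close>

locale open_knots =
  fixes p :: nat and t :: "real list" and a b :: real
  assumes sorted_knots: "sorted t"
    and length_gt: "p + 1 < length t"
    and knots_left: "i \<le> p \<Longrightarrow> t ! i = a"
    and knots_right: "num_bsplines p t \<le> i \<Longrightarrow> i < length t \<Longrightarrow> t ! i = b"
    and knots_gap: "i < num_bsplines p t \<Longrightarrow> t ! i < t ! (i + p + 1)"
begin

abbreviation "n \<equiv> num_bsplines p t"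

lemma length_knots: "length t = n + p + 1"
  using length_gt by (simp add: num_bsplines_def)

lemma knots_mono: "i \<le> j \<Longrightarrow> j < length t \<Longrightarrow> t ! i \<le> t ! j"
  using sorted_knots by (rule sorted_nth_mono)

lemma last_knots: "last t = b"
  using length_knots knots_right[of "length t - 1"] by (subst last_conv_nth) auto

lemma knots_le: "i < length t \<Longrightarrow> t ! i \<le> b"
  using knots_mono[of i "length t - 1"] knots_right[of "length t - 1"] length_knots by auto

lemma less_ends: "a < b"
proof -
  have "0 < n" using length_gt by (simp add: num_bsplines_def)
  then have "t ! 0 < t ! (p + 1)" using knots_gap[of 0] by simp
  then show ?thesis using knots_left[of 0] knots_le[of "p + 1"] length_gt by simp
qed

text \<open>The two end blocks of equal knots contain no nonempty interval, so the indices
  \<open>m - p, ..., m\<close> of the B-splines alive on the interval are all valid.\<close>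

lemma interval_index:
  assumes "m + 1 < length t" "t ! m < t ! (m + 1)"
  shows "p \<le> m" "m < n"
proof -
  show "p \<le> m"
    using assms knots_left[of m] knots_left[of "m + 1"] by force
  show "m < n"
    using assms knots_right[of m] knots_right[of "m + 1"] by force
qed

text \<open>If all these intervals were empty, the knots could not increase from \<open>i\<close> to
  \<open>i + p + 1\<close>, against \<open>knots_gap\<close>.\<close>

lemma interval_in_support:
  assumes "i < n"
  obtains m where "i \<le> m" "m \<le> i + p" "t ! m < t ! (m + 1)" "m + 1 < length t"
proof -
  have "\<exists>m. i \<le> m \<and> m \<le> i + p \<and> t ! m < t ! (m + 1)"
  proof (rule ccontr)
    assume *: "\<not> ?thesis"
    have "k \<le> p + 1 \<Longrightarrow> t ! (i + k) \<le> t ! i" for k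
    proof (induction k)
      case (Suc k)
      then show ?case using *[simplified, rule_format, of "i + k"] by force
    qed simp
    from this[of "p + 1"] show False using knots_gap[OF assms] by simp
  qed
  then show ?thesis using that assms length_knots by force
qed

lemma bspline_0_on_interval:
  assumes "m + 1 < length t" "t ! m \<le> x" "x < t ! (m + 1)" "i + 1 < length t"
  shows "bspline t 0 i x = (if i = m then 1 else 0)"
proof -
  have "x < b" using assms knots_le[of "m + 1"] by simp
  moreover have "t ! (i + 1) \<le> x" if "i < m"
    using that assms knots_mono[of "i + 1" m] by simp
  moreover have "x < t ! i" if "m < i"
    using that assms knots_mono[of "m + 1" i] by simp
  ultimately show ?thesis
    using assms last_knots by (cases i m rule: linorder_cases) auto
qed

text \<open>At \<open>b\<close> only the closing disjunct of degree 0 can hold, as no knot exceeds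
  \<open>b\<close>; it selects the last nonempty interval.\<close>

lemma bspline_0_at_end:
  assumes "m + 1 < length t" "t ! m < b" "t ! (m + 1) = b" "i + 1 < length t"
  shows "bspline t 0 i b = (if i = m then 1 else 0)"
proof -
  have "t ! (i + 1) \<le> b" using assms knots_le by simp
  moreover have "t ! (i + 1) < b" if "i < m"
    using that assms knots_mono[of "i + 1" m] by simp
  moreover have "b \<le> t ! i" if "m < i"
    using that assms knots_mono[of "m + 1" i] by simp
  ultimately show ?thesis
    using assms last_knots by (cases i m rule: linorder_cases) auto
qed

lemma locate_interval:
  assumes "x \<in> {a..b}"
  obtains m where "m + 1 < length t" "t ! m < t ! (m + 1)"
    "\<And>i. i + 1 < length t \<Longrightarrow> bspline t 0 i x = (if i = m then 1 else 0)"
proof -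
  \<comment> \<open>\<open>Q\<close> marks the knots at or left of \<open>x\<close>, but strictly
    left if \<open>x = b\<close>; its largest index thus starts a nonempty interval even at
    \<open>b\<close>.\<close>
  define Q where "Q m \<longleftrightarrow> m < length t \<and> (if x < b then t ! m \<le> x else t ! m < b)" for m
  define m where "m = Max (Collect Q)"
  have fin: "finite (Collect Q)" unfolding Q_def by simp
  have "Q 0" using assms less_ends knots_left[of 0] length_gt by (auto simp: Q_def)
  then have Qm: "Q m" unfolding m_def using fin Max_in[of "Collect Q"] by auto
  have "\<not> Q (length t - 1)"
    using knots_right[of "length t - 1"] length_knots by (auto simp: Q_def)
  then have "m \<noteq> length t - 1" using Qm by auto
  then have m: "m + 1 < length t" using Qm unfolding Q_def by auto
  have "\<not> Q (m + 1)"
    using Max_ge[OF fin, of "m + 1"] by (auto simp flip: m_def)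
  show ?thesis
  proof (cases "x < b")
    case True
    then have "t ! m \<le> x" "x < t ! (m + 1)"
      using Qm \<open>\<not> Q (m + 1)\<close> m by (auto simp: Q_def)
    then show ?thesis using that m bspline_0_on_interval by fastforce
  next
    case False
    then have "x = b" "t ! m < b" "t ! (m + 1) = b"
      using assms Qm \<open>\<not> Q (m + 1)\<close> m knots_le[of "m + 1"] by (auto simp: Q_def)
    then show ?thesis using that[OF m] m bspline_0_at_end by fastforce
  qed
qed

lemma sum_bsplines_eq_pieces:
  assumes "m < n" "\<And>i. i + 1 < length t \<Longrightarrow> bspline t 0 i x = (if i = m then 1 else 0)"
  shows "(\<Sum>i<n. c i * bspline t p i x) = (\<Sum>i\<le>m. c i * poly (bspline_piece t m p i) x)"
proof -
  have "(\<Sum>i<n. c i * bspline t p i x) = (\<Sum>i<n. c i * poly (bspline_piece t m p i) x)"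
    using bspline_eq_piece[OF assms(2)] length_knots by (intro sum.cong) auto
  also have "\<dots> = (\<Sum>i\<le>m. c i * poly (bspline_piece t m p i) x)"
    using assms(1) by (intro sum.mono_neutral_right) (auto simp: bspline_piece_eq_0)
  finally show ?thesis .
qed

text \<open>The coefficients do not depend on the interval \<open>m\<close>, so the identities on
  single intervals join into one on all of \<open>{a..b}\<close>.\<close>

lemma power_eq_sum_bsplines:
  assumes "x \<in> {a..b}" "j \<le> p"
  shows "x ^ j = (\<Sum>i<n. monom_coeff t p j i * bspline t p i x)"
proof -
  from assms(1) obtain m where m: "m + 1 < length t" "t ! m < t ! (m + 1)"
    and B: "\<And>i. i + 1 < length t \<Longrightarrow> bspline t 0 i x = (if i = m then 1 else 0)"
    by (rule locate_interval) blast
  note idx = interval_index[OF m]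
  have "x ^ j = (\<Sum>i\<le>m. monom_coeff t p j i * poly (bspline_piece t m p i) x)"
    using sorted_knots m idx length_knots assms(2) by (intro power_eq_sum_pieces) auto
  then show ?thesis using sum_bsplines_eq_pieces[OF idx(2) B] by simp
qed

lemma poly_eq_bspline_comb:
  assumes "degree q \<le> p"
  shows "\<exists>c. \<forall>x\<in>{a..b}. poly q x = bspline_comb p t c x"
proof (intro exI ballI)
  fix x assume x: "x \<in> {a..b}"
  have "poly q x = (\<Sum>j\<le>degree q. coeff q j * (\<Sum>i<n. monom_coeff t p j i * bspline t p i x))"
    unfolding poly_altdef using x assms
    by (intro sum.cong) (simp_all add: power_eq_sum_bsplines[symmetric])
  also have "\<dots> = bspline_comb p t (\<lambda>i. \<Sum>j\<le>degree q. coeff q j * monom_coeff t p j i) x"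
    unfolding bspline_comb_def sum_distrib_left sum_distrib_right
    by (subst sum.swap) (simp add: mult_ac)
  finally show "poly q x = bspline_comb p t (\<lambda>i. \<Sum>j\<le>degree q. coeff q j * monom_coeff t p j i) x" .
qed

text \<open>On one knot interval the spline is a polynomial, which infinitely many zeros force to be
  0. This form suits splines known to vanish only almost everywhere.\<close>

lemma bspline_comb_eq_0_imp:
  assumes "m + 1 < length t" "t ! m < t ! (m + 1)"
    and "infinite {x \<in> {t ! m..<t ! (m + 1)}. bspline_comb p t c x = 0}"
    and i: "i \<le> m" "m \<le> i + p"
  shows "c i = 0"
proof -
  note idx = interval_index[OF assms(1,2)]
  let ?P = "\<Sum>i\<le>m. [:c i:] * bspline_piece t m p i"
  have "bspline_comb p t c x = poly ?P x" if "x \<in> {t ! m..<t ! (m + 1)}" for x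
    using that sum_bsplines_eq_pieces[OF idx(2), of x c] bspline_0_on_interval[OF assms(1)]
    by (simp add: bspline_comb_def poly_sum)
  then have "{x \<in> {t ! m..<t ! (m + 1)}. bspline_comb p t c x = 0} \<subseteq> {x. poly ?P x = 0}"
    by auto
  then have "infinite {x. poly ?P x = 0}" using assms(3) finite_subset by blast
  then have "?P = 0" using poly_roots_finite by blast
  then show ?thesis
    using bspline_pieces_independent[of t m p c i] sorted_knots assms idx length_knots i by simp
qed

end

text \<open>A block of at most \<open>d\<close> copies is too short to hold both positions, so the
  earlier entry lies in \<open>xs\<close>. This is the induction step towards
  \<open>knots_gap\<close>.\<close>

lemma gap_append_replicate:
  fixes xs :: "'a::linorder list"
  assumes "\<And>i. i + d < length xs \<Longrightarrow> xs ! i < xs ! (i + d)"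
    and "k \<le> d" "\<And>y. y \<in> set xs \<Longrightarrow> y < v"
    and i: "i + d < length (xs @ replicate k v)"
  shows "(xs @ replicate k v) ! i < (xs @ replicate k v) ! (i + d)"
  using assms by (cases "i + d < length xs") (auto simp: nth_append)

lemma open_knots_knot_vector:
  assumes "1 \<le> \<delta>" and inc: "\<forall>k<\<delta>. x k < x (k + 1)"
  shows "open_knots p (knot_vector p \<delta> r x) (x 0) (x \<delta>)"
proof -
  \<comment> \<open>\<open>pre j\<close> is the knot vector built up to breakpoint
    \<open>x j\<close>; \<open>pre (\<delta> - 1)\<close> lacks only the final block.\<close>
  define pre where "pre j = replicate (p + 1) (x 0) @
      concat (map (\<lambda>k. replicate (p - r k) (x k)) [1..<Suc j])" for j
  have pre_Suc: "pre (Suc j) = pre j @ replicate (p - r (Suc j)) (x (Suc j))" for j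
    unfolding pre_def by simp
  have "j < \<delta> \<Longrightarrow> sorted (pre j) \<and> (\<forall>y\<in>set (pre j). y \<le> x j) \<and>
      (\<forall>i. i + (p + 1) < length (pre j) \<longrightarrow> pre j ! i < pre j ! (i + (p + 1)))" for j
  proof (induction j)
    case 0
    then show ?case by (simp add: pre_def)
  next
    case (Suc j)
    then have IH: "sorted (pre j)" "\<And>y. y \<in> set (pre j) \<Longrightarrow> y \<le> x j"
      "\<And>i. i + (p + 1) < length (pre j) \<Longrightarrow> pre j ! i < pre j ! (i + (p + 1))" by auto
    have "y < x (Suc j)" if "y \<in> set (pre j)" for y
      using IH(2)[OF that] inc[rule_format, of j] Suc.prems by simp
    with IH show ?case
      unfolding pre_Suc
      using gap_append_replicate[of "p + 1" "pre j" "p - r (Suc j)" "x (Suc j)", OF IH(3)]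
      by (auto simp: sorted_append intro: less_imp_le)
  qed
  from this[of "\<delta> - 1"] assms(1) have pre: "sorted (pre (\<delta> - 1))"
    "\<And>y. y \<in> set (pre (\<delta> - 1)) \<Longrightarrow> y \<le> x (\<delta> - 1)"
    "\<And>i. i + (p + 1) < length (pre (\<delta> - 1)) \<Longrightarrow> pre (\<delta> - 1) ! i < pre (\<delta> - 1) ! (i + (p + 1))"
    by auto
  have t: "knot_vector p \<delta> r x = pre (\<delta> - 1) @ replicate (p + 1) (x \<delta>)"
    using assms(1) by (simp add: knot_vector_def pre_def)
  have less: "y < x \<delta>" if "y \<in> set (pre (\<delta> - 1))" for y
    using pre(2)[OF that] inc[rule_format, of "\<delta> - 1"] assms(1) by simp
  have len: "length (pre (\<delta> - 1)) \<ge> p + 1" by (simp add: pre_def)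
  \<comment> \<open>The final block has length \<open>p + 1\<close>, so \<open>num_bsplines\<close>
    is the index at which it starts.\<close>
  have n: "num_bsplines p (knot_vector p \<delta> r x) = length (pre (\<delta> - 1))"
    by (simp add: num_bsplines_def t)
  show ?thesis
  proof
    show "sorted (knot_vector p \<delta> r x)"
      unfolding t using pre(1) less by (auto simp: sorted_append less_imp_le simp del: replicate_Suc)
    show "p + 1 < length (knot_vector p \<delta> r x)"
      using len unfolding t length_append length_replicate by linarith
    show "knot_vector p \<delta> r x ! i = x 0" if "i \<le> p" for i
      using that by (simp add: knot_vector_def nth_append del: replicate_Suc)
    show "knot_vector p \<delta> r x ! i = x \<delta>"
      if "num_bsplines p (knot_vector p \<delta> r x) \<le> i" "i < length (knot_vector p \<delta> r x)" for i
      using that unfolding n by (simp add: t nth_append del: replicate_Suc)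
    show "knot_vector p \<delta> r x ! i < knot_vector p \<delta> r x ! (i + p + 1)"
      if "i < num_bsplines p (knot_vector p \<delta> r x)" for i
    proof -
      have "i < length (pre (\<delta> - 1))" using that n by simp
      then show ?thesis
        unfolding t
        using gap_append_replicate[of "p + 1" "pre (\<delta> - 1)" "p + 1" "x \<delta>" i, OF pre(3) order.refl less]
        by (simp add: add.assoc del: replicate_Suc)
    qed
  qed
qed

section \<open>Square integrability and the Gram matrix\<close>

lemma borel_measurable_bspline [measurable]: "bspline t q i \<in> borel_measurable borel"
proof (induction q arbitrary: i)
  case 0
  show ?case by (simp cong: measurable_cong)
next
  case (Suc q)
  note [measurable] = Suc
  show ?case by (simp cong: measurable_cong)
qed

text \<open>The factors in the recursion are continuous, hence bounded on the compact interval; a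
  zero denominator makes its factor identically 0.\<close>

lemma bspline_bounded: "\<exists>M. \<forall>x\<in>{a..b}. \<bar>bspline t q i x\<bar> \<le> M"
proof (induction q arbitrary: i)
  case 0
  have "\<forall>x\<in>{a..b}. \<bar>bspline t 0 i x\<bar> \<le> 1" by simp
  then show ?case by blast
next
  case (Suc q)
  have lin: "\<exists>M. \<forall>x\<in>{a..b}. \<bar>f x * bspline t q j x\<bar> \<le> M" if "continuous_on {a..b} f" for f j
  proof -
    from that have "bounded (f ` {a..b})"
      by (intro compact_imp_bounded compact_continuous_image) auto
    then obtain K where K: "\<forall>x\<in>{a..b}. \<bar>f x\<bar> \<le> K"
      unfolding bounded_iff by auto
    from Suc[of j] obtain M where M: "\<forall>x\<in>{a..b}. \<bar>bspline t q j x\<bar> \<le> M" by blast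
    have "\<bar>f x * bspline t q j x\<bar> \<le> K * M" if "x \<in> {a..b}" for x
      unfolding abs_mult using K M that
      by (intro mult_mono) (auto intro: order_trans[OF abs_ge_zero])
    then show ?thesis by blast
  qed
  obtain M1 where M1: "\<forall>x\<in>{a..b}.
      \<bar>(x - t ! i) / (t ! (i + Suc q) - t ! i) * bspline t q i x\<bar> \<le> M1"
    using lin[of "\<lambda>x. (x - t ! i) / (t ! (i + Suc q) - t ! i)" i]
    by (force intro!: continuous_intros simp: divide_inverse)
  obtain M2 where M2: "\<forall>x\<in>{a..b}.
      \<bar>(t ! (i + Suc q + 1) - x) / (t ! (i + Suc q + 1) - t ! (i + 1)) * bspline t q (i + 1) x\<bar> \<le> M2"
    using lin[of "\<lambda>x. (t ! (i + Suc q + 1) - x) / (t ! (i + Suc q + 1) - t ! (i + 1))" "i + 1"]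
    by (force intro!: continuous_intros simp: divide_inverse)
  have "\<forall>x\<in>{a..b}. \<bar>bspline t (Suc q) i x\<bar> \<le> M1 + M2"
    unfolding bspline.simps using M1 M2 by (blast intro: order_trans[OF abs_triangle_ineq] add_mono)
  then show ?case by blast
qed

lemma borel_measurable_lebesgue_on:
  "g \<in> borel_measurable borel \<Longrightarrow> g \<in> borel_measurable (lebesgue_on A)"
  by (simp add: measurable_restrict_space1 measurable_completion)

text \<open>On a bounded interval \<open>\<bar>f x\<bar> \<le> 1 + (f x)\<^sup>2\<close> gives an
  integrable majorant of \<open>f\<close>, and the B-spline is a bounded factor.\<close>

lemma integrable_L2_mult_bspline:
  assumes "f \<in> L2_space a b"
  shows "integrable (lebesgue_on {a..b}) (\<lambda>x. f x * bspline t q i x)"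
proof -
  obtain M where M: "\<forall>x\<in>{a..b}. \<bar>bspline t q i x\<bar> \<le> M" using bspline_bounded by blast
  have f: "f \<in> borel_measurable (lebesgue_on {a..b})"
    "integrable (lebesgue_on {a..b}) (\<lambda>x. (f x)\<^sup>2)"
    using assms by (auto simp: L2_space_def)
  have "finite_measure (lebesgue_on {a..b})"
    by (rule finite_measure_lebesgue_on) auto
  then have "integrable (lebesgue_on {a..b}) (\<lambda>x. 1 :: real)"
    by (rule finite_measure.integrable_const)
  then have dom: "integrable (lebesgue_on {a..b}) (\<lambda>x. M * (1 + (f x)\<^sup>2))"
    using f(2) by auto
  have meas: "(\<lambda>x. f x * bspline t q i x) \<in> borel_measurable (lebesgue_on {a..b})"
    using f(1) borel_measurable_lebesgue_on[OF borel_measurable_bspline] by (rule borel_measurable_times)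
  have "\<bar>f x * bspline t q i x\<bar> \<le> \<bar>M * (1 + (f x)\<^sup>2)\<bar>" if "x \<in> {a..b}" for x
  proof -
    have "\<bar>f x\<bar> \<le> 1 + (f x)\<^sup>2"
    proof -
      have "0 \<le> (\<bar>f x\<bar> - 1)\<^sup>2 + (f x)\<^sup>2 + 1" by simp
      also have "\<dots> = 2 * (1 + (f x)\<^sup>2 - \<bar>f x\<bar>)"
        by (simp add: power2_eq_square algebra_simps)
      finally show ?thesis by simp
    qed
    then have "\<bar>f x\<bar> * \<bar>bspline t q i x\<bar> \<le> (1 + (f x)\<^sup>2) * M"
      using M that by (intro mult_mono) auto
    also have "\<dots> \<le> \<bar>M * (1 + (f x)\<^sup>2)\<bar>" by (simp add: mult.commute)
    finally show ?thesis by (simp only: abs_mult)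
  qed
  then show ?thesis
    by (intro Bochner_Integration.integrable_bound[OF dom meas] AE_I2) simp
qed

text \<open>The preceding lemma with the constant 1 makes the B-spline integrable, and a bound
  \<open>M\<close> dominates its square by \<open>M\<close> times its absolute value.\<close>

lemma bspline_L2_space: "bspline t q i \<in> L2_space a b"
proof -
  have "(\<lambda>x. 1) \<in> L2_space a b"
    using finite_measure.integrable_const[OF finite_measure_lebesgue_on[of "{a..b}"], of "1::real"]
    by (auto simp: L2_space_def)
  note int1 = integrable_L2_mult_bspline[OF this]
  obtain M where M: "\<forall>x\<in>{a..b}. \<bar>bspline t q i x\<bar> \<le> M" using bspline_bounded by blast
  have meas: "bspline t q i \<in> borel_measurable (lebesgue_on {a..b})"
    by (rule borel_measurable_lebesgue_on[OF borel_measurable_bspline])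
  have dom: "integrable (lebesgue_on {a..b}) (\<lambda>x. M * bspline t q i x)"
    using int1 by simp
  have "\<bar>(bspline t q i x)\<^sup>2\<bar> \<le> \<bar>M * bspline t q i x\<bar>" if "x \<in> {a..b}" for x
    using M that unfolding power2_eq_square abs_mult
    by (intro mult_right_mono) (auto intro: order_trans[OF _ abs_ge_self])
  then have "integrable (lebesgue_on {a..b}) (\<lambda>x. (bspline t q i x)\<^sup>2)"
    using meas by (intro Bochner_Integration.integrable_bound[OF dom] AE_I2) auto
  with meas show ?thesis by (simp add: L2_space_def)
qed

lemma L2_inner_commute: "L2_inner a b f g = L2_inner a b g f"
  by (simp add: L2_inner_def mult.commute)

lemma L2_inner_bspline_comb:
  assumes "f \<in> L2_space a b"
  shows "L2_inner a b f (bspline_comb p t c) =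
    (\<Sum>i<num_bsplines p t. c i * L2_inner a b f (bspline t p i))"
proof -
  have "(\<lambda>x. f x * bspline_comb p t c x)
      = (\<lambda>x. \<Sum>i<num_bsplines p t. c i * (f x * bspline t p i x))"
    by (simp add: bspline_comb_def sum_distrib_left mult_ac)
  then show ?thesis
    unfolding L2_inner_def
    using integrable_L2_mult_bspline[OF assms] by simp
qed

lemma integrable_bspline_comb_square:
  "integrable (lebesgue_on {a..b}) (\<lambda>x. (bspline_comb p t c x)\<^sup>2)"
proof -
  have "(\<lambda>x. (bspline_comb p t c x)\<^sup>2) = (\<lambda>x. \<Sum>i<num_bsplines p t. \<Sum>j<num_bsplines p t.
      c i * c j * (bspline t p i x * bspline t p j x))"
    by (simp add: bspline_comb_def power2_eq_square sum_product mult_ac)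
  then show ?thesis
    using integrable_L2_mult_bspline[OF bspline_L2_space] by simp
qed

lemma bspline_comb_L2_space: "bspline_comb p t c \<in> L2_space a b"
proof -
  have "bspline_comb p t c \<in> borel_measurable borel"
    unfolding bspline_comb_def by measurable
  then show ?thesis
    using integrable_bspline_comb_square borel_measurable_lebesgue_on by (simp add: L2_space_def)
qed

section \<open>Linear independence of the B-splines and uniqueness of coefficients\<close>

context open_knots
begin

text \<open>A spline of norm 0 vanishes almost everywhere, hence at infinitely many points of an
  interval in the support of the \<open>i\<close>-th B-spline, which forces
  \<open>c i = 0\<close>.\<close>

lemma L2_inner_bspline_comb_pos:
  assumes "i < n" "c i \<noteq> 0"
  shows "0 < L2_inner a b (bspline_comb p t c) (bspline_comb p t c)"
proof (rule ccontr)
  let ?L = "lebesgue_on {a..b}"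
  assume "\<not> ?thesis"
  moreover have "0 \<le> L2_inner a b (bspline_comb p t c) (bspline_comb p t c)"
    unfolding L2_inner_def by (rule Bochner_Integration.integral_nonneg) simp
  ultimately have "L2_inner a b (bspline_comb p t c) (bspline_comb p t c) = 0" by linarith
  then have "integral\<^sup>L ?L (\<lambda>x. (bspline_comb p t c x)\<^sup>2) = 0"
    by (simp add: L2_inner_def power2_eq_square)
  then have "AE x in ?L. (bspline_comb p t c x)\<^sup>2 = 0"
    using integral_nonneg_eq_0_iff_AE[OF integrable_bspline_comb_square] by simp
  then have ae: "AE x in lebesgue. x \<in> {a..b} \<longrightarrow> bspline_comb p t c x = 0"
    by (simp add: AE_restrict_space_iff)
  from assms(1) obtain m where m: "i \<le> m" "m \<le> i + p" "t ! m < t ! (m + 1)" "m + 1 < length t"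
    by (rule interval_in_support)
  let ?Z = "{x \<in> {t ! m..<t ! (m + 1)}. bspline_comb p t c x = 0}"
  have "infinite ?Z"
  \<comment> \<open>With only finitely many zeros, the interval would be a null set despite its
    positive length.\<close>
  proof
    assume "finite ?Z"
    then have "AE x in lebesgue. x \<notin> ?Z"
      by (intro AE_not_in) (simp add: negligible_finite flip: negligible_iff_null_sets)
    with ae have "AE x in lebesgue. x \<notin> {t ! m..<t ! (m + 1)}"
    proof eventually_elim
      case (elim x)
      have "a \<le> t ! m" using knots_mono[of 0 m] knots_left[of 0] m by simp
      moreover have "t ! (m + 1) \<le> b" using knots_le m by simp
      ultimately show ?case using elim by auto
    qed
    then have "{t ! m..<t ! (m + 1)} \<in> null_sets lebesgue"
      by (simp add: AE_iff_null_sets)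
    then have "emeasure lebesgue {t ! m..<t ! (m + 1)} = 0" by blast
    then show False using m(3) by simp
  qed
  then show False using bspline_comb_eq_0_imp[OF m(4,3) _ m(1,2)] assms(2) by blast
qed

lemma bspline_comb_inject:
  assumes "bspline_comb p t c = bspline_comb p t d" "i < n"
  shows "c i = d i"
proof (rule ccontr)
  assume "c i \<noteq> d i"
  then have "0 < L2_inner a b (bspline_comb p t (\<lambda>i. c i - d i)) (bspline_comb p t (\<lambda>i. c i - d i))"
    using assms(2) by (intro L2_inner_bspline_comb_pos[of i]) auto
  moreover have "bspline_comb p t (\<lambda>i. c i - d i) = (\<lambda>x. 0)"
    using assms(1) by (simp add: bspline_comb_def fun_eq_iff left_diff_distrib sum_subtractf)
  ultimately show False by (simp add: L2_inner_def)
qed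

text \<open>The definite description is justified: \<open>c\<close> cut off at \<open>n\<close> is a
  witness, and \<open>bspline_comb_inject\<close> makes it unique.\<close>

lemma bspline_coeffs_comb:
  assumes "i < n"
  shows "bspline_coeffs p t (bspline_comb p t c) i = c i"
proof -
  have "bspline_coeffs p t (bspline_comb p t c) = (\<lambda>i. if i < n then c i else 0)"
    unfolding bspline_coeffs_def
  proof (rule the_equality)
    show "(\<forall>i\<ge>n. (if i < n then c i else 0) = 0) \<and>
      bspline_comb p t c = bspline_comb p t (\<lambda>i. if i < n then c i else 0)"
      by (auto simp: bspline_comb_def intro!: ext sum.cong)
    show "d = (\<lambda>i. if i < n then c i else 0)"
      if "(\<forall>i\<ge>n. d i = 0) \<and> bspline_comb p t c = bspline_comb p t d" for d
      using that bspline_comb_inject[of c d] by (auto simp: fun_eq_iff)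
  qed
  then show ?thesis using assms by simp
qed

end

section \<open>Symmetric positive definite matrices\<close>

definition mat_form :: "nat \<Rightarrow> real mat \<Rightarrow> (nat \<Rightarrow> real) \<Rightarrow> (nat \<Rightarrow> real) \<Rightarrow> real" where
  "mat_form n A c d = (\<Sum>i<n. \<Sum>j<n. c i * A $$ (i, j) * d j)"

lemma mat_form_eq_scalar_prod:
  assumes "A \<in> carrier_mat n n"
  shows "mat_form n A c d = scalar_prod (Matrix.vec n c) (A *\<^sub>v Matrix.vec n d)"
  using assms
  by (simp add: mat_form_def scalar_prod_def atLeast0LessThan sum_distrib_left mult_ac)

lemma SPD_iff_mat_form:
  assumes A: "A \<in> carrier_mat n n"
  shows "A \<in> SPD n \<longleftrightarrow>
    transpose_mat A = A \<and> (\<forall>c. (\<exists>i<n. c i \<noteq> 0) \<longrightarrow> 0 < mat_form n A c c)"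
proof -
  have nz: "Matrix.vec n c \<noteq> 0\<^sub>v n \<longleftrightarrow> (\<exists>i<n. c i \<noteq> 0)" for c :: "nat \<Rightarrow> real"
    by (auto simp: vec_eq_iff)
  have ex: "\<exists>c. v = Matrix.vec n c" if "v \<in> carrier_vec n" for v :: "real Matrix.vec"
    using that by (intro exI[of _ "vec_index v"]) auto
  show ?thesis
  proof
    assume "A \<in> SPD n"
    then show "transpose_mat A = A \<and> (\<forall>c. (\<exists>i<n. c i \<noteq> 0) \<longrightarrow> 0 < mat_form n A c c)"
      unfolding SPD_def mat_form_eq_scalar_prod[OF A] nz[symmetric] by simp
  next
    assume "transpose_mat A = A \<and> (\<forall>c. (\<exists>i<n. c i \<noteq> 0) \<longrightarrow> 0 < mat_form n A c c)"
    then show "A \<in> SPD n"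
      unfolding SPD_def mat_form_eq_scalar_prod[OF A] nz[symmetric] using ex A by blast
  qed
qed

text \<open>A nonzero kernel vector would make the form 0, so the determinant is nonzero and
  \<open>mat_inverse\<close> does return a matrix.\<close>

lemma SPD_matrix_inverse:
  assumes "A \<in> SPD n"
  shows "matrix_inverse A \<in> carrier_mat n n"
    and "A * matrix_inverse A = 1\<^sub>m n" and "matrix_inverse A * A = 1\<^sub>m n"
proof -
  have A: "A \<in> carrier_mat n n" using assms by (simp add: SPD_def)
  have "det A \<noteq> 0"
  proof
    assume "det A = 0"
    then obtain v where v: "v \<in> carrier_vec n" "v \<noteq> 0\<^sub>v n" "A *\<^sub>v v = 0\<^sub>v n"
      using det_0_iff_vec_prod_zero_field[OF A] by blast
    then have "0 < scalar_prod v (A *\<^sub>v v)" using assms unfolding SPD_def by blast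
    then show False using v by simp
  qed
  then have "A \<in> Units (ring_mat TYPE(real) n ())" by (rule det_non_zero_imp_unit[OF A])
  then obtain B where B: "mat_inverse A = Some B"
    using mat_inverse(1)[OF A, where b = "()"] by (cases "mat_inverse A") auto
  show "matrix_inverse A \<in> carrier_mat n n"
    and "A * matrix_inverse A = 1\<^sub>m n" and "matrix_inverse A * A = 1\<^sub>m n"
    using mat_inverse(2)[OF A B] B by (simp_all add: matrix_inverse_def)
qed

text \<open>The transpose of the inverse is again a left inverse, hence equal to it. Positivity
  follows by substituting \<open>v = A w\<close>.\<close>

lemma matrix_inverse_SPD:
  assumes "A \<in> SPD n"
  shows "matrix_inverse A \<in> SPD n"
proof -
  define B where "B = matrix_inverse A"
  have A: "A \<in> carrier_mat n n" "transpose_mat A = A" using assms by (auto simp: SPD_def)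
  have B: "B \<in> carrier_mat n n" "A * B = 1\<^sub>m n" "B * A = 1\<^sub>m n"
    using SPD_matrix_inverse[OF assms] by (simp_all add: B_def)
  have "transpose_mat B * A = 1\<^sub>m n"
    using transpose_mult[OF A(1) B(1)] A(2) B(2) by simp
  then have "transpose_mat B = transpose_mat B * (A * B)"
    using B by simp
  also have "\<dots> = (transpose_mat B * A) * B"
    using A(1) B(1) by (intro assoc_mult_mat[symmetric]) auto
  also have "\<dots> = B" using \<open>transpose_mat B * A = 1\<^sub>m n\<close> B(1) by simp
  finally have sym: "transpose_mat B = B" .
  have "0 < scalar_prod v (B *\<^sub>v v)" if v: "v \<in> carrier_vec n" "v \<noteq> 0\<^sub>v n" for v
  proof -
    define w where "w = B *\<^sub>v v"
    have w: "w \<in> carrier_vec n" using B(1) v(1) by (simp add: w_def)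
    have Aw: "A *\<^sub>v w = v"
      using assoc_mult_mat_vec[OF A(1) B(1) v(1)] B(2) v(1) by (simp add: w_def)
    have "w \<noteq> 0\<^sub>v n"
    proof
      assume "w = 0\<^sub>v n"
      then have "A *\<^sub>v w = 0\<^sub>v n" using A(1) by auto
      then show False using Aw v(2) by simp
    qed
    then have "0 < scalar_prod w (A *\<^sub>v w)" using assms w by (simp add: SPD_def)
    then show ?thesis
      using Aw w v(1) comm_scalar_prod[of w n v] by (simp add: w_def)
  qed
  then show ?thesis using sym B(1) by (simp add: SPD_def B_def)
qed

lemma mult_eq_1_apply:
  fixes A B :: "real mat"
  assumes "A \<in> carrier_mat n n" "B \<in> carrier_mat n n" "A * B = 1\<^sub>m n" "i < n"
  shows "(\<Sum>j<n. A $$ (i, j) * (\<Sum>k<n. B $$ (j, k) * c k)) = c i"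
proof -
  have AB: "(\<Sum>j<n. A $$ (i, j) * B $$ (j, k)) = (if k = i then 1 else 0)" if "k < n" for k
  proof -
    have "(\<Sum>j<n. A $$ (i, j) * B $$ (j, k)) = (A * B) $$ (i, k)"
      using assms(1,2,4) that by (simp add: scalar_prod_def atLeast0LessThan)
    then show ?thesis using assms that by simp
  qed
  have "(\<Sum>j<n. A $$ (i, j) * (\<Sum>k<n. B $$ (j, k) * c k))
      = (\<Sum>k<n. (\<Sum>j<n. A $$ (i, j) * B $$ (j, k)) * c k)"
    unfolding sum_distrib_left sum_distrib_right by (subst sum.swap) (simp add: mult_ac)
  also have "\<dots> = (\<Sum>k<n. if k = i then c k else 0)"
    by (intro sum.cong) (auto simp: AB)
  also have "\<dots> = c i" using assms(4) by simp
  finally show ?thesis .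
qed

lemma mat_form_commute:
  assumes "A \<in> SPD n"
  shows "mat_form n A c d = mat_form n A d c"
proof -
  have "A $$ (i, j) = A $$ (j, i)" if "i < n" "j < n" for i j
    using assms that index_transpose_mat(1)[of i A j] by (auto simp: SPD_def)
  then show ?thesis
    unfolding mat_form_def by (subst sum.swap) (auto intro!: sum.cong)
qed

lemma mat_form_sq_diff:
  assumes "A \<in> SPD n"
  shows "mat_form n A (\<lambda>i. c i - d i) (\<lambda>i. c i - d i)
    = mat_form n A c c - 2 * mat_form n A c d + mat_form n A d d"
proof -
  have "mat_form n A (\<lambda>i. c i - d i) (\<lambda>i. c i - d i)
    = mat_form n A c c - mat_form n A c d - mat_form n A d c + mat_form n A d d"
    unfolding mat_form_def sum_subtractf[symmetric] sum.distrib[symmetric]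
    by (intro sum.cong) (auto simp: algebra_simps)
  then show ?thesis using mat_form_commute[OF assms, of d c] by simp
qed

text \<open>The exact defect of convexity; it is nonnegative for a positive definite
  \<open>A\<close> and \<open>s\<close> in \<open>{0..1}\<close>.\<close>

lemma mat_form_convex_comb:
  "mat_form n A (\<lambda>i. (1 - s) * c i + s * d i) (\<lambda>i. (1 - s) * c i + s * d i)
    = (1 - s) * mat_form n A c c + s * mat_form n A d d
      - s * (1 - s) * mat_form n A (\<lambda>i. c i - d i) (\<lambda>i. c i - d i)"
  unfolding mat_form_def sum_subtractf[symmetric] sum.distrib[symmetric] sum_distrib_left
  by (intro sum.cong) (auto simp: algebra_simps)

lemma mat_form_nonneg:
  assumes "A \<in> SPD n"
  shows "0 \<le> mat_form n A c c"
proof (cases "\<exists>i<n. c i \<noteq> 0")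
  case True
  then show ?thesis using assms SPD_iff_mat_form[of A n] by (auto simp: SPD_def intro: less_imp_le)
qed (simp add: mat_form_def)

section \<open>Gram matrix, dual basis and discrete inner product in coefficients\<close>

context open_knots
begin

text \<open>The form of the Gram matrix at \<open>c\<close> is the squared norm of the spline with
  coefficients \<open>c\<close>.\<close>

lemma gram_matrix_SPD: "gram_matrix a b p t \<in> SPD n"
proof -
  define G where "G = gram_matrix a b p t"
  have G: "G \<in> carrier_mat n n"
    "\<And>i j. i < n \<Longrightarrow> j < n \<Longrightarrow> G $$ (i, j) = L2_inner a b (bspline t p i) (bspline t p j)"
    by (auto simp: G_def gram_matrix_def)
  have "transpose_mat G = G"
    by (rule eq_matI) (use G L2_inner_commute in auto)
  moreover have "mat_form n G c c = L2_inner a b (bspline_comb p t c) (bspline_comb p t c)" for c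
  proof -
    have "L2_inner a b (bspline_comb p t c) (bspline_comb p t c)
      = (\<Sum>i<n. c i * L2_inner a b (bspline t p i) (bspline_comb p t c))"
      by (subst L2_inner_bspline_comb[OF bspline_comb_L2_space]) (simp add: L2_inner_commute)
    also have "\<dots> = mat_form n G c c"
      by (simp add: L2_inner_bspline_comb[OF bspline_L2_space] mat_form_def sum_distrib_left G mult_ac)
    finally show ?thesis by simp
  qed
  ultimately show ?thesis
    unfolding G_def[symmetric] SPD_iff_mat_form[OF G(1)] using L2_inner_bspline_comb_pos by auto
qed

text \<open>Pairing a spline with the B-splines applies the Gram matrix to its coefficients; the
  dual basis applies the inverse.\<close>

lemma L2_inner_dual_bspline:
  assumes "i < n"
  shows "L2_inner a b (bspline_comb p t c) (dual_bspline a b p t i) = c i"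
proof -
  note inv = SPD_matrix_inverse[OF gram_matrix_SPD]
  have "L2_inner a b (bspline_comb p t c) (bspline t p j)
      = (\<Sum>k<n. gram_matrix a b p t $$ (j, k) * c k)" if "j < n" for j
    using that
    by (subst L2_inner_commute)
      (simp add: L2_inner_bspline_comb[OF bspline_L2_space] gram_matrix_def mult_ac)
  then have "L2_inner a b (bspline_comb p t c) (dual_bspline a b p t i)
    = (\<Sum>j<n. matrix_inverse (gram_matrix a b p t) $$ (i, j) *
        (\<Sum>k<n. gram_matrix a b p t $$ (j, k) * c k))"
    unfolding dual_bspline_def L2_inner_bspline_comb[OF bspline_comb_L2_space] by simp
  also have "\<dots> = c i"
    using inv assms gram_matrix_SPD by (intro mult_eq_1_apply) (auto simp: SPD_def)
  finally show ?thesis .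
qed

lemma discrete_inner_comb:
  "discrete_inner p t A (bspline_comb p t c) (bspline_comb p t d) = mat_form n A c d"
  by (simp add: discrete_inner_def mat_form_def bspline_coeffs_comb)

end

section \<open>The functional in coefficients, its minimizer and polynomial reproduction\<close>

theorem theorem3p4:
  fixes a b :: real and \<delta> p :: nat and r :: "nat \<Rightarrow> nat" and x :: "nat \<Rightarrow> real"
    and t :: "real list" and S Gh :: "real mat" and f u :: "real \<Rightarrow> real"
    and J :: "(real \<Rightarrow> real) \<Rightarrow> real"
  assumes "1 \<le> \<delta>" and "x 0 = a" and "x \<delta> = b"
    and "\<forall>k<\<delta>. x k < x (k + 1)"
    and "\<forall>k\<in>{1..<\<delta>}. r k < p"
    and "t = knot_vector p \<delta> r x"
    and "is_approx_dual_basis a b p t S"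
    and "f \<in> L2_space a b"
    and "Gh = matrix_inverse S"
    and "u = (\<lambda>y. \<Sum>i<num_bsplines p t.
               L2_inner a b f (approx_dual_bspline p t S i) * bspline t p i y)"
    and "J = (\<lambda>v. 1 / 2 * discrete_inner p t Gh v v - L2_inner a b v f)"
  shows "convex_problem (spline_space p t) J
    \<and> (\<forall>v. is_arg_min J (\<lambda>w. w \<in> spline_space p t) v \<longleftrightarrow> v = u)
    \<and> (f \<in> poly_space a b p \<longrightarrow> (\<forall>y\<in>{a..b}. u y = f y))"
proof -
  interpret open_knots p t a b
    using open_knots_knot_vector[of \<delta> x p r] assms(1-4,6) by simp
  have S: "S \<in> SPD n" using assms(7) by (simp add: is_approx_dual_basis_def)
  then have Gh: "Gh \<in> SPD n" using matrix_inverse_SPD assms(9) by simp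
  define \<phi> where "\<phi> i = L2_inner a b f (bspline t p i)" for i
  define cu where "cu i = L2_inner a b f (approx_dual_bspline p t S i)" for i
  have u: "u = bspline_comb p t cu" by (simp add: assms(10) bspline_comb_def cu_def)
  have cu: "cu i = (\<Sum>j<n. S $$ (i, j) * \<phi> j)" for i
    by (simp add: cu_def approx_dual_bspline_def L2_inner_bspline_comb[OF assms(8)] \<phi>_def)
  \<comment> \<open>The stationarity equations of the quadratic function: \<open>cu\<close> is
    \<open>S\<close> applied to \<open>\<phi>\<close>, and \<open>Gh\<close> inverts
    \<open>S\<close>.\<close>
  have Gh_cu: "(\<Sum>j<n. Gh $$ (i, j) * cu j) = \<phi> i" if "i < n" for i
    unfolding cu using S SPD_matrix_inverse[OF S] assms(9) that
    by (intro mult_eq_1_apply) (auto simp: SPD_def)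
  have load: "L2_inner a b (bspline_comb p t c) f = (\<Sum>i<n. c i * \<phi> i)" for c
    by (subst L2_inner_commute) (simp add: L2_inner_bspline_comb[OF assms(8)] \<phi>_def)
  have form_cu: "(\<Sum>i<n. c i * \<phi> i) = mat_form n Gh c cu" for c
    by (simp add: mat_form_def mult.assoc flip: sum_distrib_left) (simp add: Gh_cu)
  have J: "J (bspline_comb p t c) = 1 / 2 * mat_form n Gh c c - (\<Sum>i<n. c i * \<phi> i)" for c
    by (simp add: assms(11) discrete_inner_comb load)
  \<comment> \<open>Completing the square, with the linear term rewritten by \<open>form_cu\<close>
    as the form paired with \<open>cu\<close>.\<close>
  have J_diff: "J (bspline_comb p t c) - J u
      = 1 / 2 * mat_form n Gh (\<lambda>i. c i - cu i) (\<lambda>i. c i - cu i)" for c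
    unfolding u J form_cu mat_form_sq_diff[OF Gh] by simp
  have convex: "convex_problem (spline_space p t) J"
    unfolding convex_problem_def
  proof (intro ballI)
    fix v w s assume "v \<in> spline_space p t" "w \<in> spline_space p t" and s: "s \<in> {0..1::real}"
    then obtain c d where vw: "v = bspline_comb p t c" "w = bspline_comb p t d"
      by (auto simp: spline_space_def)
    let ?m = "\<lambda>i. (1 - s) * c i + s * d i"
    have comb: "(\<lambda>x. (1 - s) * v x + s * w x) = bspline_comb p t ?m"
      by (simp add: vw bspline_comb_def sum_distrib_left distrib_right mult.assoc sum.distrib)
    have "0 \<le> s * (1 - s) * mat_form n Gh (\<lambda>i. c i - d i) (\<lambda>i. c i - d i)"
      using s mat_form_nonneg[OF Gh] by simp
    moreover have load_m: "(\<Sum>i<n. ?m i * \<phi> i)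
        = (1 - s) * (\<Sum>i<n. c i * \<phi> i) + s * (\<Sum>i<n. d i * \<phi> i)"
      by (simp add: sum_distrib_left distrib_right mult.assoc sum.distrib)
    ultimately have "J (bspline_comb p t ?m) \<le> (1 - s) * J v + s * J w"
      unfolding vw J mat_form_convex_comb load_m by (simp add: algebra_simps diff_divide_distrib)
    then show "(\<lambda>x. (1 - s) * v x + s * w x) \<in> spline_space p t \<and>
        J (\<lambda>x. (1 - s) * v x + s * w x) \<le> (1 - s) * J v + s * J w"
      unfolding comb by (auto simp: spline_space_def)
  qed
  have u_in: "u \<in> spline_space p t" by (auto simp: u spline_space_def)
  have J_less: "J u < J v" if "v \<in> spline_space p t" "v \<noteq> u" for v
  proof -
    from that obtain c where v: "v = bspline_comb p t c" by (auto simp: spline_space_def)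
    have "\<exists>i<n. c i - cu i \<noteq> 0"
    proof (rule ccontr)
      assume "\<not> ?thesis"
      then have "v = u" by (auto simp: v u bspline_comb_def)
      with that show False by simp
    qed
    then have "0 < mat_form n Gh (\<lambda>i. c i - cu i) (\<lambda>i. c i - cu i)"
      using Gh SPD_iff_mat_form[of Gh n] by (auto simp: SPD_def)
    then show ?thesis using J_diff[of c] v by simp
  qed
  \<comment> \<open>The strict inequality \<open>J_less\<close> gives both minimality of
    \<open>u\<close> and its uniqueness.\<close>
  have "is_arg_min J (\<lambda>w. w \<in> spline_space p t) v \<longleftrightarrow> v = u" for v
    unfolding is_arg_min_def using u_in J_less less_asym by metis
  moreover have "u y = f y" if f: "f \<in> poly_space a b p" and y: "y \<in> {a..b}" for y
  proof -
    from f obtain q where q: "degree q \<le> p" "\<And>x. x \<in> {a..b} \<Longrightarrow> f x = poly q x"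
      by (auto simp: poly_space_def)
    from poly_eq_bspline_comb[OF q(1)] obtain c
      where c: "\<forall>x\<in>{a..b}. poly q x = bspline_comb p t c x" by blast
    \<comment> \<open>For polynomial \<open>f\<close> the approximate dual basis may be replaced by
      the true one, whose pairings return the spline coefficients of \<open>f\<close>.\<close>
    have "cu i = c i" if "i < n" for i
    proof -
      have "cu i = L2_inner a b f (dual_bspline a b p t i)"
        using assms(7) f that by (simp add: is_approx_dual_basis_def cu_def)
      \<comment> \<open>\<open>f\<close> agrees with the spline only on \<open>{a..b}\<close>, which
        is all that the integral sees.\<close>
      also have "\<dots> = L2_inner a b (bspline_comb p t c) (dual_bspline a b p t i)"
        unfolding L2_inner_def by (rule Bochner_Integration.integral_cong) (simp_all add: q(2) c)
      also have "\<dots> = c i" using that by (rule L2_inner_dual_bspline)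
      finally show ?thesis .
    qed
    then have "u y = bspline_comb p t c y" by (simp add: u bspline_comb_def)
    then show ?thesis using q(2) c y by simp
  qed
  ultimately show ?thesis using convex by blast
qed

end
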